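(* Let $X$ be a regular topological space and let $\mathscr{O}$ be the collection of all open covers of $X$. Then $X$ is star-Rothberger (that is, $X$ satisfies $\mathbf{S}^*_1(\mathscr{O},\mathscr{O})$) if and only if $X$ satisfies the principle $\mathbf{CS}_1(\mathscr{O},\mathscr{O})$.
   Context: Regular spaces are understood as in Engelking's "General Topology" (so $T_1$ is included). For a set $Y$, $[Y]^{<\omega}$ is the collection of all finite subsets of $Y$ (including $\emptyset$; $\bigcup\emptyset=\emptyset$). For $A\subseteq X$ and a family $\mathcal{U}$ of subsets of $X$, the star of $A$ with respect to $\mathcal{U}$ is $St(A,\mathcal{U})=\bigcup\{U\in\mathcal{U}:U\cap A\neq\emptyset\}$. Let $\mathscr{A},\mathscr{B}$ be collections of families of subsets of $X$. $\mathbf{S}^*_1(\mathscr{A},\mathscr{B})$: for any sequence $\{\mathcal{A}_n:n\in\omega\}$ of elements of $\mathscr{A}$ there is a sequence $\{B_n:n\in\omega\}$ such that $B_n\in\mathcal{A}_n$ for each $n\in\omega$, and $\{St(B_n,\mathcal{A}_n):n\in\omega\}\in\mathscr{B}$. $\mathbf{CS}_1(\mathscr{A},\mathscr{B})$: for any sequence $\{\mathcal{U}_n:n\in\omega\}$ of elements of $\mathscr{A}$ there is a sequence $\{U_n:n\in\omega\}$ such that $U_n\in\mathcal{U}_n$ for each $n\in\omega$, and $\bigcup\{\mathcal{V}_n:n\in\omega\}\in\mathscr{B}$, where $\mathcal{V}_n=\{\bigcup\mathcal{V}:\mathcal{V}\in[\mathcal{U}_n]^{<\omega}\text{ and }U_n\cap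 V\neq\emptyset\text{ for each }V\in\mathcal{V}\}$. *)

theory Defs
  imports "HOL-Analysis.Analysis"
begin

definition open_covers :: "'a topology \<Rightarrow> 'a set set set" where
  "open_covers X = {\<U>. (\<forall>U\<in>\<U>. openin X U) \<and> \<Union>\<U> = topspace X}"

text \<open>Regularity in the sense of Engelking; the library's \<open>regular_space\<close> does not include
  the \<open>T\<^sub>1\<close> axiom.\<close>

definition regular_T1_space :: "'a topology \<Rightarrow> bool" where
  "regular_T1_space X \<longleftrightarrow> t1_space X \<and> regular_space X"

definition star :: "'a set \<Rightarrow> 'a set set \<Rightarrow> 'a set" where
  "star A \<U> = \<Union>{U \<in> \<U>. U \<inter> A \<noteq> {}}"

definition star_S1 :: "'a set set set \<Rightarrow> 'a set set set \<Rightarrow> bool" where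
  "star_S1 \<A> \<B> \<longleftrightarrow>
    (\<forall>\<U> :: nat \<Rightarrow> 'a set set. (\<forall>n. \<U> n \<in> \<A>) \<longrightarrow>
      (\<exists>B :: nat \<Rightarrow> 'a set. (\<forall>n. B n \<in> \<U> n) \<and> {star (B n) (\<U> n) | n. True} \<in> \<B>))"

definition CS1 :: "'a set set set \<Rightarrow> 'a set set set \<Rightarrow> bool" where
  "CS1 \<A> \<B> \<longleftrightarrow>
    (\<forall>\<U> :: nat \<Rightarrow> 'a set set. (\<forall>n. \<U> n \<in> \<A>) \<longrightarrow>
      (\<exists>U :: nat \<Rightarrow> 'a set. (\<forall>n. U n \<in> \<U> n) \<and>
        (\<Union>n. {\<Union>\<V> | \<V>. finite \<V> \<and> \<V> \<subseteq> \<U> n \<and> (\<forall>V\<in>\<V>. U n \<inter> V \<noteq> {})}) \<in> \<B>))"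

definition star_Rothberger :: "'a topology \<Rightarrow> bool" where
  "star_Rothberger X \<longleftrightarrow> star_S1 (open_covers X) (open_covers X)"

end

theory Submission imports Defs begin

text \<open>
  The two principles select the same sequences, member by member. For a single family
  \<open>\<U>\<close> and a set \<open>U\<close>, every member of \<open>\<U>\<close> meeting \<open>U\<close> is a one-element finite union, and every
  finite union of such members lies in \<open>star U \<U>\<close>; so the finite unions cover exactly
  \<open>star U \<U>\<close> (\<open>Union_finite_unions_meeting\<close>). All sets involved are unions of members of the
  given covers, hence open, and a family of open sets is an open cover as soon as its union is
  the whole space. Thus \<open>{star (U n) (\<U> n) | n. True}\<close> is an open cover if and only if the
  family of finite unions is.
\<close>

lemma Union_finite_unions_meeting:
  "\<Union>{\<Union>\<V> | \<V>. finite \<V> \<and> \<V> \<subseteq> \<U> \<and> (\<forall>V\<in>\<V>. U \<inter> V \<noteq> {})} = star U \<U>" (is "\<Union>?F = _")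
proof
  show "\<Union>?F \<subseteq> star U \<U>"
    unfolding star_def by blast
next
  show "star U \<U> \<subseteq> \<Union>?F"
  proof
    fix x assume "x \<in> star U \<U>"
    then obtain V where V: "V \<in> \<U>" "V \<inter> U \<noteq> {}" "x \<in> V"
      unfolding star_def by blast
    then have "\<Union>{V} \<in> ?F"
      by (intro CollectI exI[of _ "{V}"]) auto
    then show "x \<in> \<Union>?F"
      using V(3) by auto
  qed
qed

lemma openin_Union_subset_open_cover:
  assumes "\<U> \<in> open_covers X" "\<V> \<subseteq> \<U>"
  shows "openin X (\<Union>\<V>)"
  using assms unfolding open_covers_def by blast

lemma stars_open_cover_iff_finite_unions_open_cover:
  assumes cov: "\<And>n. \<U> n \<in> open_covers X"
  shows "{star (U n) (\<U> n) | n. True} \<in> open_covers X \<longleftrightarrow>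
    (\<Union>n. {\<Union>\<V> | \<V>. finite \<V> \<and> \<V> \<subseteq> \<U> n \<and> (\<forall>V\<in>\<V>. U n \<inter> V \<noteq> {})}) \<in> open_covers X"
    (is "?S \<in> _ \<longleftrightarrow> (\<Union>n. ?F n) \<in> _")
proof -
  have "openin X (star (U n) (\<U> n))" for n
    unfolding star_def by (rule openin_Union_subset_open_cover[OF cov]) blast
  then have S: "\<forall>W\<in>?S. openin X W"
    by blast
  have F: "\<forall>W\<in>(\<Union>n. ?F n). openin X W"
    using openin_Union_subset_open_cover[OF cov] by blast
  have "\<Union>(\<Union>n. ?F n) = (\<Union>n. \<Union>(?F n))"
    by blast
  also have "\<dots> = \<Union>?S"
    unfolding Union_finite_unions_meeting by blast
  finally show ?thesis
    using S F unfolding open_covers_def mem_Collect_eq by presburger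
qed

theorem theorem2p4:
  fixes X :: "'a topology"
  assumes "regular_T1_space X"
  shows "star_Rothberger X \<longleftrightarrow> CS1 (open_covers X) (open_covers X)"
proof -
  have "(\<exists>U. (\<forall>n. U n \<in> \<U> n) \<and> {star (U n) (\<U> n) | n. True} \<in> open_covers X) \<longleftrightarrow>
      (\<exists>U. (\<forall>n. U n \<in> \<U> n) \<and>
        (\<Union>n. {\<Union>\<V> | \<V>. finite \<V> \<and> \<V> \<subseteq> \<U> n \<and> (\<forall>V\<in>\<V>. U n \<inter> V \<noteq> {})}) \<in> open_covers X)"
    if "\<forall>n. \<U> n \<in> open_covers X" for \<U> :: "nat \<Rightarrow> 'a set set"
    by (subst stars_open_cover_iff_finite_unions_open_cover) (use that in auto)
  then show ?thesis
    unfolding star_Rothberger_def star_S1_def CS1_def by (intro all_cong)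
qed

end
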